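(* For every positive integer $L$ and every integer $n\ge 0$, we have $a_2(L,n)\ge b_2(L,n)$.
   Context: A partition of $n$ is a non-increasing finite sequence $(\lambda_1,\lambda_2,\dots)$ of positive integers summing to $n$ (the empty partition is the unique partition of $0$); its largest part is $\lambda_1$. Its Young diagram has $\lambda_i$ left-justified cells in row $i$. If $\lambda'_j$ denotes the number of cells in column $j$, the hook length of the cell in row $i$, column $j$ is $h(i,j)=\lambda_i+\lambda'_j-i-j+1$. For a positive integer $L$: $a_2(L,n)$ is the total number of cells of hook length $2$, summed over all partitions of $n$ into odd parts with largest part at most $2L-1$; $b_2(L,n)$ is the total number of cells of hook length $2$, summed over all partitions of $n$ into distinct parts with largest part at most $L$. *)

theory Defs
  imports Main
begin

text \<open>A partition is the list of its parts, largest first. Rows and columns are counted from 1,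
  so the \<open>i\<close>-th part \<open>\<lambda>\<^sub>i\<close> is \<open>part xs i = xs ! (i - 1)\<close>, used only for \<open>1 \<le> i \<le> length xs\<close>.\<close>

definition is_partition :: "nat \<Rightarrow> nat list \<Rightarrow> bool" where
  "is_partition n xs \<longleftrightarrow> sorted_wrt (\<ge>) xs \<and> (\<forall>x\<in>set xs. 0 < x) \<and> sum_list xs = n"

definition part :: "nat list \<Rightarrow> nat \<Rightarrow> nat" where
  "part xs i = xs ! (i - 1)"

text \<open>The empty partition has no first part; its largest part is read as 0, so that it
  satisfies every upper bound on the largest part.\<close>

definition largest_part :: "nat list \<Rightarrow> nat" where
  "largest_part xs = (if xs = [] then 0 else part xs 1)"

definition young_diagram :: "nat list \<Rightarrow> (nat \<times> nat) set" where
  "young_diagram xs = {(i, j). 1 \<le> i \<and> i \<le> length xs \<and> 1 \<le> j \<and> j \<le> part xs i}"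

definition column_length :: "nat list \<Rightarrow> nat \<Rightarrow> nat" where
  "column_length xs j = card {i. (i, j) \<in> young_diagram xs}"

text \<open>Integer-valued, so that the subtractions are not truncated.\<close>

definition hook_length :: "nat list \<Rightarrow> nat \<Rightarrow> nat \<Rightarrow> int" where
  "hook_length xs i j = int (part xs i) + int (column_length xs j) - int i - int j + 1"

definition num_hooks :: "int \<Rightarrow> nat list \<Rightarrow> nat" where
  "num_hooks k xs = card {(i, j) \<in> young_diagram xs. hook_length xs i j = k}"

definition odd_partitions :: "nat \<Rightarrow> nat \<Rightarrow> nat list set" where
  "odd_partitions L n =
     {xs. is_partition n xs \<and> (\<forall>x\<in>set xs. odd x) \<and> largest_part xs \<le> 2 * L - 1}"

definition distinct_partitions :: "nat \<Rightarrow> nat \<Rightarrow> nat list set" where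
  "distinct_partitions L n =
     {xs. is_partition n xs \<and> distinct xs \<and> largest_part xs \<le> L}"

definition a2 :: "nat \<Rightarrow> nat \<Rightarrow> nat" where
  "a2 L n = (\<Sum>xs\<in>odd_partitions L n. num_hooks 2 xs)"

definition b2 :: "nat \<Rightarrow> nat \<Rightarrow> nat" where
  "b2 L n = (\<Sum>xs\<in>distinct_partitions L n. num_hooks 2 xs)"

text \<open>Finiteness of the sets above, without which \<open>card\<close> and \<open>\<Sum>\<close> would silently be 0.\<close>

lemma finite_young_diagram: "finite (young_diagram xs)"
proof -
  have "young_diagram xs \<subseteq> {..length xs} \<times> {..sum_list xs}"
    by (auto simp: young_diagram_def part_def intro!: order_trans[OF _ elem_le_sum_list])
  then show ?thesis
    by (rule finite_subset) simp
qed

lemma finite_column: "finite {i. (i, j) \<in> young_diagram xs}"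
  by (rule finite_subset[of _ "{..length xs}"]) (auto simp: young_diagram_def)

lemma finite_partitions: "finite {xs. is_partition n xs}"
proof -
  have len: "length xs \<le> sum_list xs" if "\<forall>x\<in>set xs. 0 < x" for xs :: "nat list"
    using that by (induction xs) auto
  have "{xs. is_partition n xs} \<subseteq> {xs. set xs \<subseteq> {..n} \<and> length xs \<le> n}"
    by (auto simp: is_partition_def member_le_sum_list dest: len)
  then show ?thesis
    by (rule finite_subset) (simp add: finite_lists_length_le)
qed

lemma finite_odd_partitions: "finite (odd_partitions L n)"
  by (rule finite_subset[OF _ finite_partitions[of n]]) (auto simp: odd_partitions_def)

lemma finite_distinct_partitions: "finite (distinct_partitions L n)"
  by (rule finite_subset[OF _ finite_partitions[of n]]) (auto simp: distinct_partitions_def)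

end

theory Submission
  imports "HOL-Computational_Algebra.Polynomial" Defs
begin

text \<open>A cell has hook length 2 iff it is the last but one cell of the lowest row of some length
  \<open>s \<ge> 2\<close> while \<open>s - 1\<close> is not a part, or the last cell of the last but one row among the rows of
  equal length. Marking such cells, the distinct side has the generating function
  \<open>F\<^sub>L = (\<Sum>s=2..L. q\<^sup>s \<Prod>i\<notin>{s-1,s}. (1 + q\<^sup>i))\<close>, which telescopes to
  \<open>(q\<^sup>2 + \<dots> + q\<^sup>L) (\<Prod>i=2..L-1. (1 + q\<^sup>i))\<close>. On the odd side it suffices to mark odd parts
  \<open>c \<ge> 3\<close> and a repeated part 1. Removing the marked parts leaves an arbitrary partition into odd parts
  less than \<open>2L\<close>; by Glaisher's map there are at least as many of these as coefficients of
  \<open>\<Prod>i=1..L-1. (1 + q\<^sup>i)\<close> count. The claim follows because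
  \<open>(1 + q) (q\<^sup>2 + q\<^sup>3 + q\<^sup>5 + \<dots> + q\<^bsup>2L-1\<^esup>)\<close> dominates \<open>q\<^sup>2 + \<dots> + q\<^sup>L\<close>.\<close>

section \<open>Cells of hook length 2\<close>

text \<open>Rows are non-increasing, so each column occupies an initial segment
  \<open>{1..m}\<close> of the rows, and \<open>m\<close> is its cardinality.\<close>

lemma young_diagram_iff_column_length:
  assumes "sorted_wrt (\<ge>) xs" "1 \<le> j"
  shows "(i, j) \<in> young_diagram xs \<longleftrightarrow> 1 \<le> i \<and> i \<le> column_length xs j"
proof -
  define C where "C = {i. (i, j) \<in> young_diagram xs}"
  have fin: "finite C" unfolding C_def by (rule finite_column)
  have down: "i' \<in> C" if "i \<in> C" "1 \<le> i'" "i' \<le> i" for i i'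
  proof (cases "i' = i")
    case False
    with that have "xs ! (i - 1) \<le> xs ! (i' - 1)"
      by (intro sorted_wrt_nth_less[OF assms(1)]) (auto simp: C_def young_diagram_def)
    with that show ?thesis by (auto simp: C_def young_diagram_def part_def)
  qed (use that in simp)
  have pos: "1 \<le> i" if "i \<in> C" for i
    using that by (auto simp: C_def young_diagram_def)
  obtain m where m: "C = {1..m}"
  proof (cases "C = {}")
    case True
    then show ?thesis using that[of 0] by simp
  next
    case False
    have "x \<in> C \<longleftrightarrow> x \<in> {1..Max C}" for x
      using down[OF Max_in[OF fin False], of x] pos[of x] Max_ge[OF fin, of x]
      by (metis atLeastAtMost_iff)
    then show ?thesis using that by blast
  qed
  then have "(i, j) \<in> young_diagram xs \<longleftrightarrow> 1 \<le> i \<and> i \<le> m" by (auto simp: C_def)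
  moreover have "column_length xs j = m"
    using m by (simp add: column_length_def C_def)
  ultimately show ?thesis by simp
qed

lemma part_antimono:
  assumes "sorted_wrt (\<ge>) xs" "1 \<le> i" "i \<le> k" "k \<le> length xs"
  shows "part xs k \<le> part xs i"
  using sorted_wrt_nth_less[OF assms(1), of "i - 1" "k - 1"] assms
  by (cases "i = k") (auto simp: part_def)

lemma in_set_conv_part: "x \<in> set xs \<longleftrightarrow> (\<exists>i. 1 \<le> i \<and> i \<le> length xs \<and> part xs i = x)"
proof
  assume "x \<in> set xs"
  then obtain k where "k < length xs" "xs ! k = x" by (auto simp: in_set_conv_nth)
  then show "\<exists>i. 1 \<le> i \<and> i \<le> length xs \<and> part xs i = x"
    by (intro exI[of _ "Suc k"]) (auto simp: part_def)
qed (auto simp: part_def)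

lemma column_length_eq_filter:
  assumes "1 \<le> j"
  shows "column_length xs j = length (filter (\<lambda>x. j \<le> x) xs)"
proof -
  have "{i. (i, j) \<in> young_diagram xs} = Suc ` {i. i < length xs \<and> j \<le> xs ! i}"
    using assms by (force simp: young_diagram_def part_def image_iff Suc_le_eq gr0_conv_Suc)
  then show ?thesis
    by (simp add: column_length_def length_filter_conv_card card_image)
qed

text \<open>Distinct parts leave only cells with one cell to the right and none below; such a cell
  is recovered from the length of its row.\<close>

lemma num_hooks_2_distinct_le:
  assumes "sorted_wrt (\<ge>) xs" "distinct xs"
  shows "num_hooks 2 xs \<le> card {s \<in> set xs. 2 \<le> s \<and> s - 1 \<notin> set xs}"
proof -
  let ?H = "{(i, j) \<in> young_diagram xs. hook_length xs i j = 2}"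
  have cell: "part xs i = j + 1 \<and> column_length xs j = i \<and> 1 \<le> i \<and> i \<le> length xs \<and> 1 \<le> j"
    if "(i, j) \<in> ?H" for i j
  proof -
    have Y: "(i, j) \<in> young_diagram xs" and h: "hook_length xs i j = 2" using that by auto
    then have ij: "1 \<le> i" "i \<le> length xs" "1 \<le> j" "j \<le> part xs i"
      by (auto simp: young_diagram_def)
    have leg: "i \<le> column_length xs j"
      using young_diagram_iff_column_length[OF assms(1) ij(3)] Y by blast
    \<comment> \<open>A cell at the end of its row would have exactly one cell below it, making row
      \<open>i + 1\<close> as long as row \<open>i\<close>.\<close>
    have "part xs i \<noteq> j"
    proof
      assume eq: "part xs i = j"
      with h have "column_length xs j = i + 1" by (simp add: hook_length_def)
      then have "(i + 1, j) \<in> young_diagram xs"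
        using young_diagram_iff_column_length[OF assms(1) ij(3)] by simp
      then have "i + 1 \<le> length xs" "j \<le> part xs (i + 1)" by (auto simp: young_diagram_def)
      moreover from this have "part xs (i + 1) \<noteq> part xs i"
        using assms(2) ij by (auto simp: part_def nth_eq_iff_index_eq)
      ultimately show False
        using part_antimono[OF assms(1) ij(1), of "i + 1"] eq by simp
    qed
    with h leg ij show ?thesis by (auto simp: hook_length_def)
  qed
  have "inj_on (\<lambda>(i, j). part xs i) ?H"
  proof (rule inj_onI, clarify)
    fix i j i' j'
    assume *: "(i, j) \<in> young_diagram xs" "hook_length xs i j = 2"
      "(i', j') \<in> young_diagram xs" "hook_length xs i' j' = 2" "part xs i = part xs i'"
    then show "i = i' \<and> j = j'"
      using cell[of i j] cell[of i' j'] by auto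
  qed
  moreover have "(\<lambda>(i, j). part xs i) ` ?H \<subseteq> {s \<in> set xs. 2 \<le> s \<and> s - 1 \<notin> set xs}"
  proof (rule image_subsetI, clarify)
    fix i j assume *: "(i, j) \<in> young_diagram xs" "hook_length xs i j = 2"
    then have c: "part xs i = j + 1" "column_length xs j = i" "1 \<le> i" "i \<le> length xs" "1 \<le> j"
      using cell[of i j] by auto
    \<comment> \<open>A row of length \<open>j\<close> meets column \<open>j\<close>, whose lowest
      cell is in row \<open>i\<close>; lying at or above row \<open>i\<close>, it would have at
      least \<open>j + 1\<close> cells.\<close>
    have "j \<notin> set xs"
    proof
      assume "j \<in> set xs"
      then obtain k where k: "1 \<le> k" "k \<le> length xs" "part xs k = j"
        by (auto simp: in_set_conv_part)
      then have "(k, j) \<in> young_diagram xs" using c by (auto simp: young_diagram_def)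
      then have "k \<le> i"
        using young_diagram_iff_column_length[OF assms(1) c(5)] c(2) by simp
      from part_antimono[OF assms(1) k(1) this c(4)] k(3) c(1) show False by simp
    qed
    moreover have "part xs i \<in> set xs" using c in_set_conv_part by blast
    ultimately show "part xs i \<in> set xs \<and> 2 \<le> part xs i \<and> part xs i - 1 \<notin> set xs"
      using c by simp
  qed
  ultimately show ?thesis
    unfolding num_hooks_def by (intro card_inj_on_le) auto
qed

text \<open>The mark 2 stands for a repeated part 1, every other mark for a part.\<close>

definition marked_parts :: "nat \<Rightarrow> nat multiset" where
  "marked_parts c = (if c = 2 then {#1, 1#} else {#c#})"

text \<open>Each mark is the sum of its marked parts. A single part 1 gives no mark, as its row has
  no last but one cell.\<close>

definition marks :: "nat \<Rightarrow> nat set" where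
  "marks L = insert 2 ((\<lambda>j. 2 * j - 1) ` {2..L})"

lemma marksE:
  assumes "c \<in> marks L"
  obtains "c = 2" | "odd c" "3 \<le> c" "c \<le> 2 * L - 1"
  using assms by (force simp: marks_def)

text \<open>The last but one cell of the lowest row of odd length \<open>c \<ge> 3\<close> has hook
  length 2, as does the last but one cell of column 1 if 1 is repeated. Repeated larger parts give
  further cells, hence only an inequality.\<close>

lemma num_hooks_2_odd_ge:
  assumes "sorted_wrt (\<ge>) xs" "\<forall>x\<in>set xs. odd x"
  shows "card {c \<in> marks L. marked_parts c \<subseteq># mset xs} \<le> num_hooks 2 xs"
proof -
  let ?H = "{(i, j) \<in> young_diagram xs. hook_length xs i j = 2}"
  let ?C = "{c \<in> marks L. marked_parts c \<subseteq># mset xs}"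
  define f where "f c = (if c = 2 then (length xs - 1, 1) else (column_length xs c, c - 1))" for c
  \<comment> \<open>The column tells the marks apart: it is 1 for the mark 2 and
    \<open>c - 1 \<ge> 2\<close> otherwise.\<close>
  have "inj_on f ?C"
    by (rule inj_onI) (auto simp: f_def split: if_splits elim!: marksE)
  moreover have "f ` ?C \<subseteq> ?H"
  proof (rule image_subsetI)
    fix c assume c: "c \<in> ?C"
    then have sub: "marked_parts c \<subseteq># mset xs" by simp
    from c have "c \<in> marks L" by simp
    then show "f c \<in> ?H"
    proof (cases rule: marksE)
      case 1
      have "2 \<le> count (mset xs) 1"
        using mset_subset_eq_count[OF sub, of 1] 1 by (simp add: marked_parts_def)
      \<comment> \<open>Odd parts other than 1 reach column 2, so exactly the rows of length 1 are
        missing from it.\<close>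
      moreover have "count (mset xs) 1 + length (filter (\<lambda>x. 2 \<le> x) xs) = length xs"
        using assms(2)
      proof (induction xs)
        case (Cons a xs)
        then show ?case by (cases "a = 1") (auto elim!: oddE)
      qed simp
      ultimately have len: "2 \<le> length xs" "column_length xs 2 < length xs - 1"
        by (auto simp: column_length_eq_filter)
      have col1: "column_length xs 1 = length xs"
        using assms(2) by (auto simp: column_length_eq_filter Suc_le_eq odd_pos
            intro!: filter_True arg_cong[of _ _ length])
      have Y: "(length xs - 1, 1) \<in> young_diagram xs"
        using young_diagram_iff_column_length[OF assms(1), of 1 "length xs - 1"] col1 len by auto
      have "(length xs - 1, 2) \<notin> young_diagram xs"
        using young_diagram_iff_column_length[OF assms(1), of 2 "length xs - 1"] len by auto
      with Y have "part xs (length xs - 1) = 1" by (auto simp: young_diagram_def)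
      with Y col1 len show ?thesis by (auto simp: f_def 1 hook_length_def)
    next
      case 2
      then have "c \<noteq> 2" by auto
      with sub have "c \<in> set xs" by (simp add: marked_parts_def)
      then obtain k where k: "1 \<le> k" "k \<le> length xs" "part xs k = c"
        by (auto simp: in_set_conv_part)
      define i where "i = column_length xs c"
      have "(k, c) \<in> young_diagram xs" using k 2 by (auto simp: young_diagram_def)
      then have ki: "k \<le> i"
        using young_diagram_iff_column_length[OF assms(1), of c k] 2 by (simp add: i_def)
      have iY: "(i, c) \<in> young_diagram xs"
        using young_diagram_iff_column_length[OF assms(1), of c i] 2 ki k by (simp add: i_def)
      then have i: "i \<le> length xs" "c \<le> part xs i" by (auto simp: young_diagram_def)
      have "part xs i = c"
        using part_antimono[OF assms(1) k(1) ki i(1)] i k by simp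
      \<comment> \<open>The even number \<open>c - 1\<close> is not a part, so columns
        \<open>c - 1\<close> and \<open>c\<close> end in the same row.\<close>
      moreover have "(c - 1 \<le> x) = (c \<le> x)" if "x \<in> set xs" for x
      proof -
        have "c - 1 \<noteq> x" using that assms(2) 2 by auto
        then show ?thesis by auto
      qed
      then have "column_length xs (c - 1) = i"
        using 2 by (simp add: i_def column_length_eq_filter cong: filter_cong)
      moreover have "(i, c - 1) \<in> young_diagram xs"
        using iY 2 by (auto simp: young_diagram_def)
      ultimately show ?thesis
        using 2 \<open>c \<noteq> 2\<close> by (auto simp: f_def i_def[symmetric] hook_length_def)
    qed
  qed
  moreover have "finite ?H"
    by (rule finite_subset[OF _ finite_young_diagram]) auto
  ultimately show ?thesis
    unfolding num_hooks_def by (rule card_inj_on_le)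
qed

section \<open>Glaisher's map\<close>

text \<open>Each \<open>2\<^sup>e m\<close> with \<open>m\<close> odd is sent to \<open>2\<^sup>e\<close> copies of \<open>m\<close>, the first argument being a bound on
  the exponents \<open>e\<close>. Reading the multiplicities modulo 2 recovers the odd elements.\<close>

primrec glaisher :: "nat \<Rightarrow> nat set \<Rightarrow> nat multiset" where
  "glaisher 0 S = {#}"
| "glaisher (Suc k) S = mset_set {s \<in> S. odd s} + repeat_mset 2 (glaisher k {s. 2 * s \<in> S})"

lemma finite_halves: "finite (S :: nat set) \<Longrightarrow> finite {s. 2 * s \<in> S}"
  using finite_vimageI[of S "\<lambda>s. 2 * s"] by (simp add: vimage_def inj_on_def)

lemma halves_subset: "S \<subseteq> {1..<2 ^ Suc k} \<Longrightarrow> {s. 2 * s \<in> S} \<subseteq> {1..<2 ^ k :: nat}"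
  by auto

text \<open>The bound \<open>2 ^ k\<close> makes \<open>S\<close> empty at \<open>k = 0\<close>, so
  \<open>k\<close> halvings exhaust it. Each step splits off the odd elements, and
  \<open>repeat_mset 2\<close> makes up for the halving.\<close>

lemma sum_mset_glaisher:
  "S \<subseteq> {1..<2 ^ k} \<Longrightarrow> sum_mset (glaisher k S) = \<Sum>S"
proof (induction k arbitrary: S)
  case (Suc k)
  have fin: "finite S" using Suc.prems finite_subset by blast
  have "S = {s \<in> S. odd s} \<union> (*) 2 ` {s. 2 * s \<in> S}"
    by (auto elim!: evenE)
  then have "\<Sum>S = \<Sum>{s \<in> S. odd s} + \<Sum>((*) 2 ` {s. 2 * s \<in> S})"
    using fin finite_halves[OF fin]
    by (metis (no_types, lifting) sum.union_disjoint finite_Un finite_imageI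
        disjoint_iff mem_Collect_eq imageE dvd_triv_left)
  also have "\<Sum>((*) 2 ` {s. 2 * s \<in> S}) = 2 * \<Sum>{s. 2 * s \<in> S}"
    by (subst sum.reindex) (auto simp: inj_on_def sum_distrib_left)
  finally show ?case
    using Suc.IH[OF halves_subset[OF Suc.prems]]
    by (simp add: sum_unfold_sum_mset numeral_2_eq_2)
qed simp

lemma set_glaisher:
  "x \<in># glaisher k S \<Longrightarrow> odd x \<and> (\<exists>s\<in>S. x \<le> s)"
proof (induction k arbitrary: S)
  case (Suc k)
  show ?case
  proof (cases "x \<in> {s \<in> S. odd s}")
    case False
    \<comment> \<open>\<open>S\<close> is arbitrary here and \<open>mset_set\<close> is empty on
      infinite sets, hence the case distinction.\<close>
    then have "x \<in># glaisher k {s. 2 * s \<in> S}"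
      using Suc.prems
      by (cases "finite {s \<in> S. odd s}") (auto simp flip: count_greater_zero_iff)
    from Suc.IH[OF this] obtain a where "odd x" "2 * a \<in> S" "x \<le> a" by auto
    then show ?thesis by (intro conjI bexI[of _ "2 * a"]) auto
  qed auto
qed simp

lemma glaisher_inj:
  "\<lbrakk>S \<subseteq> {1..<2 ^ k}; T \<subseteq> {1..<2 ^ k}; glaisher k S = glaisher k T\<rbrakk> \<Longrightarrow> S = T"
proof (induction k arbitrary: S T)
  case (Suc k)
  have fin: "finite S" "finite T" using Suc.prems finite_subset by blast+
  have cnt: "count (glaisher (Suc k) U) m
      = of_bool (m \<in> U \<and> odd m) + 2 * count (glaisher k {s. 2 * s \<in> U}) m"
    if "finite U" for U m
    using that by (simp add: count_mset_set')
  \<comment> \<open>Each multiplicity is a bit plus an even number: the bit gives the odd elements,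
    and half of the rest feeds the induction.\<close>
  have "of_bool (m \<in> S \<and> odd m) = (of_bool (m \<in> T \<and> odd m) :: nat)
      \<and> count (glaisher k {s. 2 * s \<in> S}) m = count (glaisher k {s. 2 * s \<in> T}) m" for m
  proof -
    have "of_bool (m \<in> S \<and> odd m) + 2 * count (glaisher k {s. 2 * s \<in> S}) m
        = of_bool (m \<in> T \<and> odd m) + 2 * count (glaisher k {s. 2 * s \<in> T}) m"
      using cnt[OF fin(1), of m] cnt[OF fin(2), of m] Suc.prems(3) by metis
    then show ?thesis by (auto simp: of_bool_def split: if_splits; presburger)
  qed
  then have odds: "m \<in> S \<and> odd m \<longleftrightarrow> m \<in> T \<and> odd m"
    and halves: "glaisher k {s. 2 * s \<in> S} = glaisher k {s. 2 * s \<in> T}" for m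
    by (auto simp: multiset_eq_iff of_bool_eq_iff)
  have "{s. 2 * s \<in> S} = {s. 2 * s \<in> T}"
    using Suc.IH[OF halves_subset[OF Suc.prems(1)] halves_subset[OF Suc.prems(2)] halves] .
  then have "m \<in> S \<longleftrightarrow> m \<in> T" for m
    using odds[of m] by (cases "even m") (auto elim!: evenE)
  then show ?case by blast
qed simp

section \<open>Reduction to subset sums\<close>

lemma largest_part_le_iff:
  "sorted_wrt (\<ge>) xs \<Longrightarrow> largest_part xs \<le> m \<longleftrightarrow> (\<forall>x\<in>set xs. x \<le> m)"
  by (cases xs) (auto simp: largest_part_def part_def)

text \<open>The least elements of the maximal runs of consecutive integers, except for a run
  starting at 1.\<close>

definition run_starts :: "nat set \<Rightarrow> nat set" where
  "run_starts S = {s \<in> S. 2 \<le> s \<and> s - 1 \<notin> S}"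

text \<open>A partition into distinct parts is determined by its set of parts.\<close>

lemma b2_le:
  "b2 L n \<le> (\<Sum>S | S \<subseteq> {1..L} \<and> \<Sum>S = n. card (run_starts S))"
proof -
  have "b2 L n \<le> (\<Sum>xs\<in>distinct_partitions L n. card (run_starts (set xs)))"
    unfolding b2_def run_starts_def
    by (rule sum_mono, rule num_hooks_2_distinct_le)
      (auto simp: distinct_partitions_def is_partition_def)
  also have "\<dots> = (\<Sum>S\<in>set ` distinct_partitions L n. card (run_starts S))"
  proof (subst sum.reindex)
    show "inj_on set (distinct_partitions L n)"
    proof (rule inj_onI)
      fix xs ys assume *: "xs \<in> distinct_partitions L n" "ys \<in> distinct_partitions L n" "set xs = set ys"
      then have "sorted (rev xs)" "sorted (rev ys)" "distinct (rev xs)" "distinct (rev ys)"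
        by (auto simp: distinct_partitions_def is_partition_def sorted_wrt_rev)
      from sorted_distinct_set_unique[OF this(1,3,2,4)] *(3) show "xs = ys" by simp
    qed
  qed simp
  also have "\<dots> \<le> (\<Sum>S | S \<subseteq> {1..L} \<and> \<Sum>S = n. card (run_starts S))"
  proof (rule sum_mono2)
    show "finite {S. S \<subseteq> {1..L} \<and> \<Sum>S = n}"
      by (rule finite_subset[of _ "Pow {1..L}"]) auto
    show "set ` distinct_partitions L n \<subseteq> {S. S \<subseteq> {1..L} \<and> \<Sum>S = n}"
      by (auto simp: distinct_partitions_def is_partition_def largest_part_le_iff
          distinct_sum_list_conv_Sum Suc_le_eq)
  qed simp
  finally show ?thesis .
qed

text \<open>A pair \<open>(c, S)\<close> yields the odd partition
  \<open>marked_parts c + glaisher L S\<close> with mark \<open>c\<close>. Keeping \<open>c\<close>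
  makes this injective: the marked parts cancel and Glaisher's map is injective.\<close>

lemma a2_ge:
  assumes "1 \<le> L"
  shows "card {(c, S). c \<in> marks L \<and> S \<subseteq> {1..L - 1} \<and> c + \<Sum>S = n} \<le> a2 L n"
proof -
  let ?A = "{(c, S). c \<in> marks L \<and> S \<subseteq> {1..L - 1} \<and> c + \<Sum>S = n}"
  let ?B = "SIGMA xs:odd_partitions L n. {c \<in> marks L. marked_parts c \<subseteq># mset xs}"
  define g where
    "g = (\<lambda>(c, S). (rev (sorted_list_of_multiset (marked_parts c + glaisher L S)), c :: nat))"
  have bound: "S \<subseteq> {1..<2 ^ L}" if "S \<subseteq> {1..L - 1}" for S :: "nat set"
  proof
    fix s assume "s \<in> S"
    with that have "s \<in> {1..L - 1}" by blast
    then have "1 \<le> s" "s \<le> L" by auto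
    then show "s \<in> {1..<2 ^ L}" using le_less_trans[OF _ less_exp] by simp
  qed
  have finm: "finite (marks L)" by (simp add: marks_def)
  have "inj_on g ?A"
  proof (rule inj_onI)
    fix p p' assume p: "p \<in> ?A" "p' \<in> ?A" "g p = g p'"
    obtain c S c' S' where eqs: "p = (c, S)" "p' = (c', S')" by (metis surj_pair)
    have c: "c' = c" using p(3) by (simp add: g_def eqs)
    have "mset (fst (g p)) = mset (fst (g p'))" using p(3) by (rule arg_cong)
    then have "marked_parts c + glaisher L S = marked_parts c + glaisher L S'"
      by (simp add: g_def eqs c)
    then have "glaisher L S = glaisher L S'" by (rule add_left_imp_eq)
    moreover have "S \<subseteq> {1..<2 ^ L}" "S' \<subseteq> {1..<2 ^ L}"
      by (rule bound, use p(1,2) in \<open>simp add: eqs\<close>)+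
    ultimately have "S = S'" by (intro glaisher_inj[of S L S'])
    then show "p = p'" by (simp only: eqs c)
  qed
  moreover have "g ` ?A \<subseteq> ?B"
  proof (rule image_subsetI)
    fix p assume "p \<in> ?A"
    then obtain c S where p: "p = (c, S)"
      and c: "c \<in> marks L" and S: "S \<subseteq> {1..L - 1}" and n: "c + \<Sum>S = n" by blast
    let ?M = "marked_parts c + glaisher L S"
    let ?xs = "rev (sorted_list_of_multiset ?M)"
    have mset: "mset ?xs = ?M" by simp
    have set: "set ?xs = set_mset ?M" by simp
    have odd: "odd x \<and> x \<le> 2 * L - 1" if "x \<in># ?M" for x
    proof (cases "x \<in># glaisher L S")
      case True
      from set_glaisher[OF this] S show ?thesis by fastforce
    next
      case False
      then have "x \<in># marked_parts c" using that by simp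
      then show ?thesis using c assms
        by (auto simp: marked_parts_def split: if_splits elim!: marksE)
    qed
    have sorted: "sorted_wrt (\<ge>) ?xs" by (simp add: sorted_wrt_rev)
    have "sum_list ?xs = sum_mset (mset ?xs)" by (rule sum_mset_sum_list[symmetric])
    also have "\<dots> = n"
      unfolding mset using sum_mset_glaisher[OF bound[OF S]] n by (simp add: marked_parts_def)
    finally have "is_partition n ?xs"
      unfolding is_partition_def using sorted odd by (auto simp: set odd_pos)
    then have "?xs \<in> odd_partitions L n"
      unfolding odd_partitions_def using odd by (auto simp: largest_part_le_iff[OF sorted] set)
    then show "g p \<in> ?B"
      using c by (simp add: g_def p)
  qed
  moreover have "finite ?B"
    using finm by (intro finite_SigmaI finite_odd_partitions) simp
  ultimately have A: "card ?A \<le> card ?B" by (rule card_inj_on_le)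
  have B: "card ?B
      = (\<Sum>xs\<in>odd_partitions L n. card {c \<in> marks L. marked_parts c \<subseteq># mset xs})"
    using finm by (simp add: card_SigmaI finite_odd_partitions)
  have "card ?B \<le> a2 L n"
    unfolding B a2_def
  proof (rule sum_mono)
    fix xs assume "xs \<in> odd_partitions L n"
    then have "sorted_wrt (\<ge>) xs" "\<forall>x\<in>set xs. odd x"
      by (simp_all add: odd_partitions_def is_partition_def)
    then show "card {c \<in> marks L. marked_parts c \<subseteq># mset xs} \<le> num_hooks 2 xs"
      by (rule num_hooks_2_odd_ge)
  qed
  with A show ?thesis by (rule le_trans)
qed

section \<open>Generating functions\<close>

text \<open>The identities avoid subtraction, so that \<open>q\<close> can later be the
  indeterminate of \<open>nat poly\<close>, where an extra summand never lowers a
  coefficient.\<close>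

context
  fixes q :: "'a :: comm_semiring_1"
begin

definition subset_gf :: "nat \<Rightarrow> 'a" where
  "subset_gf L = (\<Sum>S\<in>Pow {1..L}. q ^ \<Sum>S)"

definition run_gf :: "nat \<Rightarrow> 'a" where
  "run_gf L = (\<Sum>S\<in>Pow {1..L}. of_nat (card (run_starts S)) * q ^ \<Sum>S)"

lemma sum_Pow_atLeast1_Suc:
  fixes f :: "nat set \<Rightarrow> 'a"
  shows "(\<Sum>S\<in>Pow {1..Suc L}. f S)
    = (\<Sum>S\<in>Pow {1..L}. f S) + (\<Sum>S\<in>Pow {1..L}. f (insert (Suc L) S))"
proof -
  have "{1..Suc L} = insert (Suc L) {1..L}" by auto
  then have "Pow {1..Suc L} = Pow {1..L} \<union> insert (Suc L) ` Pow {1..L}"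
    by (simp only: Pow_insert)
  moreover have "inj_on (insert (Suc L)) (Pow {1..L})"
    by (rule inj_onI) (metis PowD Suc_n_not_le_n atLeastAtMost_iff insert_ident subsetD)
  moreover have "Pow {1..L} \<inter> insert (Suc L) ` Pow {1..L} = {}" by auto
  ultimately show ?thesis
    by (simp add: sum.union_disjoint sum.reindex)
qed

lemma sum_insert_Suc: "S \<in> Pow {1..L} \<Longrightarrow> \<Sum>(insert (Suc L) S) = Suc L + \<Sum>S"
  by (subst sum.insert) (auto intro: finite_subset)

lemma subset_gf_Suc: "subset_gf (Suc L) = (1 + q ^ Suc L) * subset_gf L"
proof -
  have "(\<Sum>S\<in>Pow {1..L}. q ^ \<Sum>(insert (Suc L) S)) = q ^ Suc L * subset_gf L"
    unfolding subset_gf_def sum_distrib_left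
    by (rule sum.cong) (simp_all only: sum_insert_Suc power_add)
  then show ?thesis
    by (simp only: subset_gf_def[of "Suc L"] sum_Pow_atLeast1_Suc distrib_right mult_1_left)
      (simp only: subset_gf_def)
qed

text \<open>The factor for \<open>i = 1\<close> is kept apart: it will multiply the sum over the
  marks, and the other factors also occur in \<open>run_gf_closed\<close>.\<close>

lemma subset_gf_eq_prod: "subset_gf (Suc L) = (1 + q) * (\<Prod>i=2..Suc L. 1 + q ^ i)"
proof (induction L)
  case 0
  show ?case using subset_gf_Suc[of 0] by (simp add: subset_gf_def)
next
  case (Suc L)
  show ?case
    by (simp only: subset_gf_Suc[of "Suc L"] Suc.IH) (simp add: ac_simps)
qed

text \<open>The new largest element starts a run iff its predecessor is absent, and it affects no
  smaller element.\<close>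

lemma card_run_starts_insert:
  assumes "S \<subseteq> {1..Suc L}"
  shows "card (run_starts (insert (Suc (Suc L)) S))
    = card (run_starts S) + of_bool (Suc L \<notin> S)"
proof -
  have fin: "finite (run_starts S)"
    using finite_subset[OF assms] by (simp add: run_starts_def)
  have "run_starts (insert (Suc (Suc L)) S)
      = (if Suc L \<notin> S then insert (Suc (Suc L)) (run_starts S) else run_starts S)"
  proof -
    have le: "s < Suc (Suc L)" if "s \<in> S" for s using that assms by auto
    have "s \<in> run_starts (insert (Suc (Suc L)) S)
        \<longleftrightarrow> (s = Suc (Suc L) \<and> Suc L \<notin> S) \<or> s \<in> run_starts S" for s
      using le[of s] le[of "Suc (Suc L)"]
      by (cases "s = Suc (Suc L)"; cases "s \<in> S") (auto simp: run_starts_def)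
    then show ?thesis by auto
  qed
  moreover have "Suc (Suc L) \<notin> run_starts S"
    using assms by (auto simp: run_starts_def)
  ultimately show ?thesis using fin by simp
qed

lemma run_gf_Suc:
  "run_gf (Suc (Suc L)) = (1 + q ^ Suc (Suc L)) * run_gf (Suc L) + q ^ Suc (Suc L) * subset_gf L"
proof -
  \<comment> \<open>The sets in which the inserted \<open>Suc (Suc L)\<close> starts a new run are
    those avoiding \<open>Suc L\<close>, that is, the subsets of \<open>{1..L}\<close>.\<close>
  have subset: "subset_gf L = (\<Sum>S\<in>Pow {1..Suc L}. of_bool (Suc L \<notin> S) * q ^ \<Sum>S)"
    unfolding sum_Pow_atLeast1_Suc subset_gf_def
    by (auto intro!: sum.cong simp: subset_iff)
  have run: "run_gf (Suc (Suc L)) = run_gf (Suc L)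
      + (\<Sum>S\<in>Pow {1..Suc L}. (of_nat (card (run_starts S)) + of_bool (Suc L \<notin> S))
          * (q ^ Suc (Suc L) * q ^ \<Sum>S))"
    unfolding run_gf_def sum_Pow_atLeast1_Suc[of _ "Suc L"]
    by (intro arg_cong2[of _ _ _ _ plus] refl sum.cong)
      (simp only: sum_insert_Suc power_add card_run_starts_insert Pow_iff of_nat_add of_nat_of_bool)
  show ?thesis
    unfolding run subset
    by (simp only: run_gf_def distrib_right distrib_left sum.distrib sum_distrib_left mult.left_commute
        add.assoc mult_1_left)
qed

lemma run_gf_closed:
  "run_gf (Suc L) = (\<Sum>i=2..Suc L. q ^ i) * (\<Prod>i=2..L. 1 + q ^ i)"
proof (induction L)
  case 0
  have "run_starts S = {}" if "S \<subseteq> {Suc 0}" for S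
    using that by (auto simp: run_starts_def)
  then show ?case by (simp add: run_gf_def)
next
  case (Suc L)
  show ?case
  proof (cases L)
    case 0
    then show ?thesis
      using Suc.IH run_gf_Suc[of 0] by (simp add: subset_gf_def numeral_2_eq_2)
  next
    case (Suc K)
    define T where "T = (\<Sum>i=2..Suc L. q ^ i)"
    define E where "E = (\<Prod>i=2..L. 1 + q ^ i)"
    have shift: "q * T + q ^ 2 = T + q ^ Suc (Suc L)"
    proof -
      have "q ^ 2 + (\<Sum>i=2..Suc L. q ^ Suc i) = (\<Sum>i=2..Suc (Suc L). q ^ i)"
        by (subst (2) sum.atLeast_Suc_atMost, simp, subst sum.shift_bounds_cl_Suc_ivl)
          (simp add: numeral_2_eq_2)
      also have "\<dots> = T + q ^ Suc (Suc L)"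
        by (subst sum.cl_ivl_Suc) (simp add: T_def)
      finally show ?thesis
        by (simp only: T_def sum_distrib_left power_Suc add.commute)
    qed
    have "run_gf (Suc (Suc L)) = (1 + q ^ Suc (Suc L)) * (T * E) + q ^ Suc (Suc L) * ((1 + q) * E)"
      using run_gf_Suc[of L] Suc.IH subset_gf_eq_prod[of K] \<open>L = Suc K\<close>
      by (simp only: T_def E_def)
    also have "\<dots> = (T + q ^ Suc (Suc L) + q ^ Suc L * (q * T + q ^ 2)) * E"
      by (simp add: algebra_simps power2_eq_square)
    also have "\<dots> = (T + q ^ Suc (Suc L)) * (E * (1 + q ^ Suc L))"
      unfolding shift by (simp add: algebra_simps)
    finally show ?thesis
      by (simp add: T_def E_def Suc)
  qed
qed

text \<open>\<open>(1 + q) * q ^ (2 * j - 1)\<close> covers the exponents \<open>2 * j - 1\<close>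
  and \<open>2 * j\<close>, so the odd marks cover 3 to \<open>2 * L\<close>. The mark 2 supplies
  exponent 2 and the surplus \<open>q ^ 3\<close>.\<close>

lemma marks_gf:
  assumes "2 \<le> L"
  shows "(1 + q) * (\<Sum>c\<in>marks L. q ^ c) = (\<Sum>i=2..L. q ^ i) + (\<Sum>i=Suc L..2 * L. q ^ i) + q ^ 3"
proof -
  have "inj_on (\<lambda>j. 2 * j - 1) {2..L}" by (auto simp: inj_on_def)
  moreover have "2 \<notin> (\<lambda>j. 2 * j - 1) ` {2..L}" by (auto simp: image_iff; presburger)
  ultimately have m: "(\<Sum>c\<in>marks L. q ^ c) = q ^ 2 + (\<Sum>j=2..L. q ^ (2 * j - 1))"
    by (simp add: marks_def sum.reindex)
  have "q ^ 2 + (\<Sum>j=2..L. q ^ (2 * j - 1)) * (1 + q) = (\<Sum>i=2..2 * L. q ^ i)"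
    using assms
  proof (induction L rule: dec_induct)
    case base
    show ?case by (simp add: numeral_eq_Suc algebra_simps)
  next
    case (step k)
    have "q ^ 2 + (\<Sum>j=2..Suc k. q ^ (2 * j - 1)) * (1 + q)
        = (q ^ 2 + (\<Sum>j=2..k. q ^ (2 * j - 1)) * (1 + q)) + (q ^ (2 * k + 1) + q ^ (2 * k + 2))"
      using step.hyps by (simp add: algebra_simps)
    also have "\<dots> = (\<Sum>i=2..2 * Suc k. q ^ i)"
      unfolding step.IH using step.hyps by (simp add: add.assoc)
    finally show ?case .
  qed
  moreover have "(\<Sum>i=2..2 * L. q ^ i) = (\<Sum>i=2..L. q ^ i) + (\<Sum>i=Suc L..2 * L. q ^ i)"
    using sum.ub_add_nat[of 2 L "\<lambda>i. q ^ i" L] assms by (simp add: mult_2)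
  moreover have split: "(1 + q) * (q ^ 2 + U) = (q ^ 2 + U * (1 + q)) + q ^ 3" for U
    by (simp add: distrib_left distrib_right ac_simps power3_eq_cube power2_eq_square)
  ultimately show ?thesis
    using split by (simp only: m)
qed

end

section \<open>Comparison of coefficients\<close>

lemma coeff_sum_monom_weighted:
  fixes w f :: "'a \<Rightarrow> nat"
  assumes "finite A"
  shows "coeff (\<Sum>x\<in>A. of_nat (w x) * monom 1 1 ^ f x) n = (\<Sum>x | x \<in> A \<and> f x = n. w x)"
  using assms
  by (simp add: coeff_sum of_nat_poly monom_power sum.If_cases if_distrib Int_def
      Collect_conj_eq[symmetric] cong: if_cong)

theorem theorem2p3:
  fixes L n :: nat
  assumes "L \<ge> 1"
  shows "a2 L n \<ge> b2 L n"
\<comment> \<open>For \<open>L = 1\<close> there are no run starts, so the bound on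
  \<open>b2\<close> is 0; \<open>marks_gf\<close> takes over from \<open>L = 2\<close>.\<close>
proof (cases "L = 1")
  case True
  have "run_starts S = {}" if "S \<subseteq> {Suc 0}" for S
    using that by (auto simp: run_starts_def)
  then show ?thesis using b2_le[of 1 n] True by simp
next
  case False
  then obtain K where L: "L = Suc (Suc K)"
    using assms by (metis One_nat_def not0_implies_Suc not_one_le_zero)
  define q :: "nat poly" where "q = monom 1 1"
  define E where "E = (\<Prod>i=2..Suc K. 1 + q ^ i)"
  have "(\<Sum>c\<in>marks L. q ^ c) * subset_gf q (L - 1) = (1 + q) * (\<Sum>c\<in>marks L. q ^ c) * E"
    using subset_gf_eq_prod[of q K] by (simp add: L E_def ac_simps)
  \<comment> \<open>Both sides share the factor \<open>E\<close>, so the surplus in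
    \<open>marks_gf\<close> becomes a separate summand with natural coefficients.\<close>
  also have "\<dots> = run_gf q L + ((\<Sum>i=Suc L..2 * L. q ^ i) + q ^ 3) * E"
    using marks_gf[of L q] run_gf_closed[of q "Suc K"] by (simp add: L E_def algebra_simps)
  finally have "coeff (run_gf q L) n \<le> coeff ((\<Sum>c\<in>marks L. q ^ c) * subset_gf q (L - 1)) n"
    by simp
  \<comment> \<open>The factor \<open>of_nat 1\<close> gives the shape of
    \<open>coeff_sum_monom_weighted\<close> with weight 1, so that the coefficient is a
    cardinality.\<close>
  also have "(\<Sum>c\<in>marks L. q ^ c) * subset_gf q (L - 1)
      = (\<Sum>x\<in>marks L \<times> Pow {1..L - 1}. of_nat 1 * q ^ (fst x + \<Sum>(snd x)))"
    by (simp add: subset_gf_def sum_product sum.cartesian_product power_add case_prod_unfold)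
  also have "coeff \<dots> n = card {x \<in> marks L \<times> Pow {1..L - 1}. fst x + \<Sum>(snd x) = n}"
    unfolding q_def by (subst coeff_sum_monom_weighted) (auto simp: marks_def)
  also have "{x \<in> marks L \<times> Pow {1..L - 1}. fst x + \<Sum>(snd x) = n}
      = {(c, S). c \<in> marks L \<and> S \<subseteq> {1..L - 1} \<and> c + \<Sum>S = n}"
    by auto
  also have "card \<dots> \<le> a2 L n" by (rule a2_ge[OF assms])
  finally have "coeff (run_gf q L) n \<le> a2 L n" .
  moreover have "coeff (run_gf q L) n = (\<Sum>S | S \<subseteq> {1..L} \<and> \<Sum>S = n. card (run_starts S))"
    unfolding run_gf_def q_def by (subst coeff_sum_monom_weighted) auto
  ultimately show ?thesis using b2_le[of L n] by simp
qed

end
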